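(* Let $\alpha$ and $\beta$ be left-computable real numbers such that $\alpha+\beta$ is superspeedable. Then at least one of $\alpha$ or $\beta$ is superspeedable.
   Context: A real $x$ is left-computable if there is a left-approximation of $x$, i.e. a computable increasing sequence $(x_n)_n$ of rationals converging to $x$. $x$ is superspeedable if it has a left-approximation with $\limsup_{n\to\infty}\frac{x_{n+1}-x_n}{x-x_n}=1$. *)

theory Defs
  imports Complex_Main "HOL-Library.Extended_Real"
begin

text \<open>Kleene's partial recursive functions, acting on argument lists.\<close>

datatype recf =
    Zero
  | Succ
  | Proj nat
  | Comp recf "recf list"
  | PrimRec recf recf
  | Mu recf

inductive rec_eval :: "recf \<Rightarrow> nat list \<Rightarrow> nat \<Rightarrow> bool" where
  Zero: "rec_eval Zero xs 0"
| Succ: "rec_eval Succ [x] (Suc x)"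
| Proj: "i < length xs \<Longrightarrow> rec_eval (Proj i) xs (xs ! i)"
| Comp: "list_all2 (\<lambda>g y. rec_eval g xs y) gs ys \<Longrightarrow> rec_eval f ys z
    \<Longrightarrow> rec_eval (Comp f gs) xs z"
| PrimRec_0: "rec_eval f xs y \<Longrightarrow> rec_eval (PrimRec f g) (0 # xs) y"
| PrimRec_Suc: "rec_eval (PrimRec f g) (n # xs) y \<Longrightarrow> rec_eval g (n # y # xs) z
    \<Longrightarrow> rec_eval (PrimRec f g) (Suc n # xs) z"
| Mu: "rec_eval f (n # xs) 0 \<Longrightarrow> (\<forall>m<n. \<exists>y. rec_eval f (m # xs) (Suc y))
    \<Longrightarrow> rec_eval (Mu f) xs n"

inductive_cases rec_eval_ZeroE: "rec_eval Zero xs y"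
inductive_cases rec_eval_SuccE: "rec_eval Succ xs y"
inductive_cases rec_eval_ProjE: "rec_eval (Proj i) xs y"
inductive_cases rec_eval_CompE: "rec_eval (Comp f gs) xs y"
inductive_cases rec_eval_PrimRec_0E: "rec_eval (PrimRec f g) (0 # xs) y"
inductive_cases rec_eval_PrimRec_SucE: "rec_eval (PrimRec f g) (Suc n # xs) y"
inductive_cases rec_eval_MuE: "rec_eval (Mu f) xs y"

lemma rec_eval_deterministic:
  "rec_eval f xs y \<Longrightarrow> rec_eval f xs z \<Longrightarrow> y = z"
proof (induction arbitrary: z rule: rec_eval.induct)
  case (Zero xs)
  then show ?case by (elim rec_eval_ZeroE) simp
next
  case (Succ x)
  then show ?case by (elim rec_eval_SuccE) simp
next
  case (Proj i xs)
  then show ?case by (elim rec_eval_ProjE) simp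
next
  case (Comp xs gs ys f w)
  from Comp.prems obtain ys' where
    ys': "list_all2 (\<lambda>g y. rec_eval g xs y) gs ys'" "rec_eval f ys' z"
    by (elim rec_eval_CompE) blast
  have "ys = ys'"
    using Comp.IH(1) ys'(1) by (intro nth_equalityI) (simp_all add: list_all2_conv_all_nth)
  with Comp.IH(2) ys'(2) show ?case by simp
next
  case (PrimRec_0 f xs y g)
  from PrimRec_0.prems have "rec_eval f xs z" by (elim rec_eval_PrimRec_0E)
  then show ?case by (rule PrimRec_0.IH)
next
  case (PrimRec_Suc f g n xs y w)
  from PrimRec_Suc.prems obtain y' where
    "rec_eval (PrimRec f g) (n # xs) y'" "rec_eval g (n # y' # xs) z"
    by (elim rec_eval_PrimRec_SucE) blast
  with PrimRec_Suc.IH show ?case by metis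
next
  case (Mu f n xs)
  from Mu.prems have z: "rec_eval f (z # xs) 0" "\<forall>m<z. \<exists>y. rec_eval f (m # xs) (Suc y)"
    by (elim rec_eval_MuE; simp)+
  show ?case
  proof (rule linorder_cases[of n z])
    assume "n < z"
    with z(2) Mu.IH(1) show ?thesis by blast
  next
    assume "z < n"
    with z(1) Mu.IH(2) show ?thesis by blast
  qed
qed

definition computable :: "(nat \<Rightarrow> nat) \<Rightarrow> bool" where
  "computable f \<longleftrightarrow> (\<exists>p. \<forall>n. rec_eval p [n] (f n))"

definition computable_rat_seq :: "(nat \<Rightarrow> rat) \<Rightarrow> bool" where
  "computable_rat_seq q \<longleftrightarrow>
    (\<exists>a b c. computable a \<and> computable b \<and> computable c \<and>
      (\<forall>n. c n \<noteq> 0 \<and> q n = (of_nat (a n) - of_nat (b n)) / of_nat (c n)))"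

text \<open>Increasing is read strictly, so that \<^term>\<open>x - of_rat (q n)\<close> is never zero
  for a left-approximation \<^term>\<open>q\<close> of \<^term>\<open>x\<close>.\<close>

definition left_approximation :: "(nat \<Rightarrow> rat) \<Rightarrow> real \<Rightarrow> bool" where
  "left_approximation q x \<longleftrightarrow>
    computable_rat_seq q \<and> strict_mono q \<and> (\<lambda>n. of_rat (q n)) \<longlonglongrightarrow> x"

definition left_computable :: "real \<Rightarrow> bool" where
  "left_computable x \<longleftrightarrow> (\<exists>q. left_approximation q x)"

definition superspeedable :: "real \<Rightarrow> bool" where
  "superspeedable x \<longleftrightarrow>
    (\<exists>q. left_approximation q x \<and>
      limsup (\<lambda>n. ereal ((of_rat (q (Suc n)) - of_rat (q n)) / (x - of_rat (q n)))) = 1)"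

end

theory Submission
  imports Defs
begin

text \<open>
  A superspeedable real \<open>x\<close> is superspeedable along a computable subsequence of any given
  left-approximation \<open>d\<close>: if \<open>c\<close> witnesses superspeedability, alternate between \<open>c\<close> and \<open>d\<close>,
  from \<open>d (t k)\<close> searching first for a larger term of \<open>c\<close> and then for a term \<open>d (t (k + 1))\<close>
  above that. Every step of \<open>c\<close> lies within two consecutive steps of \<open>d \<circ> t\<close>, so if the step of
  \<open>c\<close> shrinks the distance to \<open>x\<close> by a factor \<open>\<epsilon>\<^sup>2\<close>, then one of the two steps of \<open>d \<circ> t\<close> shrinks it
  by a factor \<open>\<epsilon>\<close>.

  Apply this to \<open>\<alpha> + \<beta>\<close> and the sum \<open>a + b\<close> of left-approximations of \<open>\<alpha>\<close> and \<open>\<beta>\<close>. If, for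
  some \<open>\<epsilon> > 0\<close>, the steps of \<open>a \<circ> t\<close> and \<open>b \<circ> t\<close> eventually all leave more than the fraction \<open>\<epsilon>\<close>
  of their respective distances, then so do the steps of the sum, a contradiction.
\<close>

section \<open>Closure properties of computable functions\<close>

text \<open>Programs act on lists of any length; fixing the length \<open>k\<close> gives
  \<open>k\<close>-ary total functions, whose closure properties can be proved without writing
  programs by hand. Values of \<open>F\<close> on other lengths are irrelevant.\<close>

definition total_rec :: "nat \<Rightarrow> (nat list \<Rightarrow> nat) \<Rightarrow> bool" where
  "total_rec k F \<longleftrightarrow> (\<exists>p. \<forall>xs. length xs = k \<longrightarrow> rec_eval p xs (F xs))"

lemma computable_iff_total_rec: "computable f \<longleftrightarrow> total_rec 1 (\<lambda>xs. f (xs ! 0))"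
proof -
  have "(\<forall>xs. length xs = 1 \<longrightarrow> rec_eval p xs (f (xs ! 0))) \<longleftrightarrow> (\<forall>n. rec_eval p [n] (f n))" for p
    by (auto simp: length_Suc_conv)
  then show ?thesis
    by (simp add: computable_def total_rec_def)
qed

lemma total_rec_nth: "i < k \<Longrightarrow> total_rec k (\<lambda>xs. xs ! i)"
  unfolding total_rec_def by (blast intro: rec_eval.Proj)

lemma total_rec_comp1:
  assumes "total_rec 1 (\<lambda>xs. f (xs ! 0))" and "total_rec k F"
  shows "total_rec k (\<lambda>xs. f (F xs))"
proof -
  from assms obtain p q where p: "\<And>xs. length xs = 1 \<Longrightarrow> rec_eval p xs (f (xs ! 0))"
    and q: "\<And>xs. length xs = k \<Longrightarrow> rec_eval q xs (F xs)"
    unfolding total_rec_def by blast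
  have "rec_eval (Comp p [q]) xs (f (F xs))" if "length xs = k" for xs
    by (rule rec_eval.Comp[where ys = "[F xs]"]) (use q[OF that] p[of "[F xs]"] in simp_all)
  then show ?thesis
    unfolding total_rec_def by blast
qed

lemma total_rec_comp2:
  assumes "total_rec 2 (\<lambda>xs. f (xs ! 0) (xs ! 1))" and "total_rec k F" and "total_rec k G"
  shows "total_rec k (\<lambda>xs. f (F xs) (G xs))"
proof -
  from assms obtain p q r where p: "\<And>xs. length xs = 2 \<Longrightarrow> rec_eval p xs (f (xs ! 0) (xs ! 1))"
    and q: "\<And>xs. length xs = k \<Longrightarrow> rec_eval q xs (F xs)"
    and r: "\<And>xs. length xs = k \<Longrightarrow> rec_eval r xs (G xs)"
    unfolding total_rec_def by blast
  have "rec_eval (Comp p [q, r]) xs (f (F xs) (G xs))" if "length xs = k" for xs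
    by (rule rec_eval.Comp[where ys = "[F xs, G xs]"])
      (use q[OF that] r[OF that] p[of "[F xs, G xs]"] in simp_all)
  then show ?thesis
    unfolding total_rec_def by blast
qed

text \<open>The recursion runs on the head of the list. In the step function, \<open>xs ! 0\<close>
  is the counter, \<open>xs ! 1\<close> the previous value and \<open>xs ! 2\<close> the first
  parameter.\<close>

lemma total_rec_primrec:
  assumes "total_rec k F" and "total_rec (Suc (Suc k)) G"
    and "\<And>xs. length xs = k \<Longrightarrow> H 0 xs = F xs"
    and "\<And>n xs. length xs = k \<Longrightarrow> H (Suc n) xs = G (n # H n xs # xs)"
  shows "total_rec (Suc k) (\<lambda>xs. H (hd xs) (tl xs))"
proof -
  from assms(1,2) obtain p q where p: "\<And>xs. length xs = k \<Longrightarrow> rec_eval p xs (F xs)"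
    and q: "\<And>xs. length xs = Suc (Suc k) \<Longrightarrow> rec_eval q xs (G xs)"
    unfolding total_rec_def by blast
  have "rec_eval (PrimRec p q) (n # xs) (H n xs)" if "length xs = k" for n xs
  proof (induction n)
    case 0
    show ?case using p[OF that] assms(3)[OF that] by (simp add: rec_eval.PrimRec_0)
  next
    case (Suc n)
    show ?case
      using rec_eval.PrimRec_Suc[OF Suc q[of "n # H n xs # xs"]] that by (simp add: assms(4))
  qed
  then have "rec_eval (PrimRec p q) xs (H (hd xs) (tl xs))" if "length xs = Suc k" for xs
    using that by (auto simp: length_Suc_conv)
  then show ?thesis
    unfolding total_rec_def by blast
qed

lemma total_rec_cong:
  "total_rec k F \<Longrightarrow> (\<And>xs. length xs = k \<Longrightarrow> F xs = G xs) \<Longrightarrow> total_rec k G"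
  unfolding total_rec_def by metis

lemma total_rec_Suc:
  assumes "total_rec k F"
  shows "total_rec k (\<lambda>xs. Suc (F xs))"
proof (rule total_rec_comp1[OF _ assms])
  have "\<forall>xs. length xs = 1 \<longrightarrow> rec_eval Succ xs (Suc (xs ! 0))"
    by (auto simp: length_Suc_conv intro: rec_eval.Succ)
  then show "total_rec 1 (\<lambda>xs. Suc (xs ! 0))"
    unfolding total_rec_def by blast
qed

lemma total_rec_zero: "total_rec k (\<lambda>xs. 0)"
  unfolding total_rec_def by (blast intro: rec_eval.Zero)

lemma total_rec_add:
  assumes "total_rec k F" and "total_rec k G"
  shows "total_rec k (\<lambda>xs. F xs + G xs)"
proof (rule total_rec_comp2[OF _ assms])
  have "total_rec (Suc 1) (\<lambda>xs. hd xs + tl xs ! 0)"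
    by (rule total_rec_primrec[where F = "\<lambda>xs. xs ! 0" and G = "\<lambda>xs. Suc (xs ! 1)"])
      (auto intro: total_rec_nth total_rec_Suc)
  then show "total_rec 2 (\<lambda>xs. xs ! 0 + xs ! 1)"
    unfolding numeral_2_eq_2 One_nat_def by (rule total_rec_cong) (auto simp: length_Suc_conv)
qed

lemma total_rec_mult:
  assumes "total_rec k F" and "total_rec k G"
  shows "total_rec k (\<lambda>xs. F xs * G xs)"
proof (rule total_rec_comp2[OF _ assms])
  have "total_rec (Suc 1) (\<lambda>xs. hd xs * tl xs ! 0)"
    by (rule total_rec_primrec[where F = "\<lambda>xs. 0" and G = "\<lambda>xs. xs ! 1 + xs ! 2"])
      (simp_all add: total_rec_nth total_rec_zero total_rec_add)
  then show "total_rec 2 (\<lambda>xs. xs ! 0 * xs ! 1)"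
    unfolding numeral_2_eq_2 One_nat_def by (rule total_rec_cong) (auto simp: length_Suc_conv)
qed

lemma total_rec_pred:
  assumes "total_rec k F"
  shows "total_rec k (\<lambda>xs. F xs - 1)"
proof (rule total_rec_comp1[OF _ assms])
  have "total_rec (Suc 0) (\<lambda>xs. hd xs - 1)"
    by (rule total_rec_primrec[where F = "\<lambda>xs. 0" and G = "\<lambda>xs. xs ! 0"])
      (auto intro: total_rec_nth total_rec_zero)
  then show "total_rec 1 (\<lambda>xs. xs ! 0 - 1)"
    unfolding One_nat_def by (rule total_rec_cong) (auto simp: length_Suc_conv)
qed

lemma total_rec_diff:
  assumes "total_rec k F" and "total_rec k G"
  shows "total_rec k (\<lambda>xs. F xs - G xs)"
proof (rule total_rec_comp2[OF _ assms(2,1), where f = "\<lambda>m n. n - m"])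
  \<comment> \<open>Truncated subtraction recurses on the subtrahend, taking one predecessor per
    step, so the subtrahend has to come first.\<close>
  have "total_rec (Suc 1) (\<lambda>xs. tl xs ! 0 - hd xs)"
    by (rule total_rec_primrec[where F = "\<lambda>xs. xs ! 0" and G = "\<lambda>xs. xs ! 1 - 1"])
      (auto intro: total_rec_nth total_rec_pred[simplified])
  then show "total_rec 2 (\<lambda>xs. xs ! 1 - xs ! 0)"
    unfolding numeral_2_eq_2 One_nat_def by (rule total_rec_cong) (auto simp: length_Suc_conv)
qed

lemma computable_comp: "computable f \<Longrightarrow> computable g \<Longrightarrow> computable (\<lambda>n. f (g n))"
  unfolding computable_iff_total_rec by (rule total_rec_comp1)

lemma total_rec_computable:
  "computable f \<Longrightarrow> i < k \<Longrightarrow> total_rec k (\<lambda>xs. f (xs ! i))"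
  unfolding computable_iff_total_rec by (rule total_rec_comp1[OF _ total_rec_nth])

lemma computable_iterate:
  assumes "computable f"
  shows "computable (\<lambda>n. (f ^^ n) 0)"
proof -
  have "total_rec (Suc 0) (\<lambda>xs. (f ^^ hd xs) 0)"
    by (rule total_rec_primrec[where F = "\<lambda>xs. 0" and G = "\<lambda>xs. f (xs ! 1)"])
      (auto intro: total_rec_zero total_rec_computable[OF assms])
  then show ?thesis
    unfolding computable_iff_total_rec One_nat_def
    by (rule total_rec_cong) (auto simp: length_Suc_conv)
qed

text \<open>Unbounded search on the first argument: \<open>Mu\<close> demands a positive value at
  every smaller candidate, which follows from minimality and the totality of
  \<open>F\<close>.\<close>

lemma computable_Least:
  assumes "total_rec 2 (\<lambda>xs. F (xs ! 0) (xs ! 1))" and "\<And>n. \<exists>m. F m n = 0"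
  shows "computable (\<lambda>n. LEAST m. F m n = 0)"
proof -
  from assms(1) obtain p where p: "\<And>xs. length xs = 2 \<Longrightarrow> rec_eval p xs (F (xs ! 0) (xs ! 1))"
    unfolding total_rec_def by blast
  have p: "rec_eval p [m, n] (F m n)" for m n
    using p[of "[m, n]"] by simp
  have "rec_eval (Mu p) [n] (LEAST m. F m n = 0)" for n
  proof (rule rec_eval.Mu, goal_cases)
    case 1
    show ?case using p[of "LEAST m. F m n = 0" n] LeastI_ex[OF assms(2)[of n]] by simp
  next
    case 2
    show ?case
    proof (intro allI impI)
      fix m assume "m < (LEAST m. F m n = 0)"
      then have "F m n \<noteq> 0" by (rule not_less_Least)
      then show "\<exists>y. rec_eval p [m, n] (Suc y)"
        using p[of m n] by (metis not0_implies_Suc)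
    qed
  qed
  then show ?thesis
    unfolding computable_def by blast
qed

section \<open>Computable sequences of rationals\<close>

lemma computable_rat_seq_comp:
  assumes "computable_rat_seq q" and "computable t"
  shows "computable_rat_seq (\<lambda>n. q (t n))"
proof -
  from assms(1) obtain a b c where "computable a" "computable b" "computable c"
    and "\<And>n. c n \<noteq> 0 \<and> q n = (of_nat (a n) - of_nat (b n)) / of_nat (c n)"
    unfolding computable_rat_seq_def by blast
  then show ?thesis
    unfolding computable_rat_seq_def
    by (intro exI[of _ "\<lambda>n. a (t n)"] exI[of _ "\<lambda>n. b (t n)"] exI[of _ "\<lambda>n. c (t n)"])
      (simp add: computable_comp assms(2))
qed

lemma computable_rat_seq_add:
  assumes "computable_rat_seq q" and "computable_rat_seq r"
  shows "computable_rat_seq (\<lambda>n. q n + r n)"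
proof -
  from assms(1) obtain a b c where abc: "computable a" "computable b" "computable c"
    and q: "\<And>n. c n \<noteq> 0 \<and> q n = (of_nat (a n) - of_nat (b n)) / of_nat (c n)"
    unfolding computable_rat_seq_def by blast
  from assms(2) obtain a' b' c' where abc': "computable a'" "computable b'" "computable c'"
    and r: "\<And>n. c' n \<noteq> 0 \<and> r n = (of_nat (a' n) - of_nat (b' n)) / of_nat (c' n)"
    unfolding computable_rat_seq_def by blast
  have "computable (\<lambda>n. a n * c' n + a' n * c n)" "computable (\<lambda>n. b n * c' n + b' n * c n)"
    "computable (\<lambda>n. c n * c' n)"
    using abc abc' unfolding computable_iff_total_rec
    by (simp_all only: total_rec_add total_rec_mult)
  moreover have "c n * c' n \<noteq> 0 \<and> q n + r n =
      (of_nat (a n * c' n + a' n * c n) - of_nat (b n * c' n + b' n * c n)) / of_nat (c n * c' n)" for n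
    using q[of n] r[of n] by (auto simp: field_simps)
  ultimately show ?thesis
    unfolding computable_rat_seq_def by blast
qed

lemma computable_search_greater:
  assumes "computable_rat_seq q" and "computable_rat_seq r" and "\<And>n. \<exists>m. q n < r m"
  obtains f where "computable f" and "\<And>n. q n < r (f n)"
proof -
  from assms(1) obtain a b c where abc: "computable a" "computable b" "computable c"
    and q: "\<And>n. c n \<noteq> 0 \<and> q n = (of_nat (a n) - of_nat (b n)) / of_nat (c n)"
    unfolding computable_rat_seq_def by blast
  from assms(2) obtain a' b' c' where abc': "computable a'" "computable b'" "computable c'"
    and r: "\<And>n. c' n \<noteq> 0 \<and> r n = (of_nat (a' n) - of_nat (b' n)) / of_nat (c' n)"
    unfolding computable_rat_seq_def by blast
  \<comment> \<open>Clearing the positive denominators and moving all negative terms across turns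
    \<open>q n < r m\<close> into a comparison \<open>L < R\<close> of naturals; this holds exactly
    when the truncated difference \<open>Suc L - R\<close> vanishes.\<close>
  define F where "F m n = Suc (a n * c' m + b' m * c n) - (a' m * c n + b n * c' m)" for m n
  have F: "F m n = 0 \<longleftrightarrow> q n < r m" for m n
  proof -
    have "q n < r m \<longleftrightarrow> (of_nat (a n) - of_nat (b n) :: rat) * of_nat (c' m)
        < (of_nat (a' m) - of_nat (b' m)) * of_nat (c n)"
      using q[of n] r[of m] by (simp add: divide_less_eq less_divide_eq field_simps)
    also have "\<dots> \<longleftrightarrow> (of_nat (a n * c' m + b' m * c n) :: rat) < of_nat (a' m * c n + b n * c' m)"
      by (simp add: algebra_simps)
    also have "\<dots> \<longleftrightarrow> F m n = 0"
      unfolding of_nat_less_iff F_def by simp linarith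
    finally show ?thesis ..
  qed
  have "total_rec 2 (\<lambda>xs. F (xs ! 0) (xs ! 1))"
    unfolding F_def
    by (intro total_rec_diff total_rec_Suc total_rec_add total_rec_mult total_rec_computable abc abc')
      simp_all
  then have "computable (\<lambda>n. LEAST m. F m n = 0)"
    by (rule computable_Least) (simp add: F assms(3))
  moreover have "q n < r (LEAST m. F m n = 0)" for n
    unfolding F by (rule LeastI_ex) (rule assms(3))
  ultimately show ?thesis
    using that by blast
qed

section \<open>Left-approximations\<close>

lemma left_approximation_less:
  assumes "left_approximation q x"
  shows "of_rat (q n) < x"
proof -
  \<comment> \<open>The limit bounds terms only weakly; strictness at \<open>n\<close> comes from
    bounding the next term.\<close>
  have "of_rat (q (Suc n)) \<le> x"
  proof (rule LIMSEQ_le_const)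
    show "(\<lambda>n. of_rat (q n)) \<longlonglongrightarrow> x"
      using assms by (simp add: left_approximation_def)
    show "\<exists>N. \<forall>m\<ge>N. of_rat (q (Suc n)) \<le> (of_rat (q m) :: real)"
      using assms by (auto simp: left_approximation_def of_rat_less_eq strict_mono_less_eq)
  qed
  moreover have "of_rat (q n) < (of_rat (q (Suc n)) :: real)"
    using assms by (simp add: left_approximation_def of_rat_less strict_mono_less)
  ultimately show ?thesis by linarith
qed

lemma left_approximation_exceeds:
  assumes "left_approximation q x" and "of_rat y < x"
  shows "\<exists>n. y < q n"
proof -
  have "eventually (\<lambda>n. of_rat y < (of_rat (q n) :: real)) sequentially"
    using assms order_tendstoD(1) by (auto simp: left_approximation_def)
  then show ?thesis
    by (auto simp: eventually_sequentially of_rat_less)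
qed

lemma left_approximation_subseq:
  assumes "left_approximation q x" and "computable t" and "strict_mono t"
  shows "left_approximation (\<lambda>n. q (t n)) x"
  using assms LIMSEQ_subseq_LIMSEQ[of "\<lambda>n. of_rat (q n) :: real" x t]
  by (auto simp: left_approximation_def computable_rat_seq_comp strict_mono_def comp_def)

lemma left_approximation_add:
  assumes "left_approximation p x" and "left_approximation q y"
  shows "left_approximation (\<lambda>n. p n + q n) (x + y)"
  using assms
  by (auto simp: left_approximation_def computable_rat_seq_add of_rat_add strict_mono_def
      intro: tendsto_add add_strict_mono)

text \<open>For positive \<open>r\<close> this says, without division, that the ratios
  \<open>r (Suc n) / r n\<close> have limit inferior 0. It is applied to the distances from an
  approximation to its limit.\<close>

definition shrinks_fast :: "(nat \<Rightarrow> real) \<Rightarrow> bool" where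
  "shrinks_fast r \<longleftrightarrow> (\<forall>\<epsilon>>0. \<exists>\<^sub>F n in sequentially. r (Suc n) \<le> \<epsilon> * r n)"

text \<open>The quotient is 1 minus the ratio of consecutive distances, hence at most 1. Its limsup
  is below 1 exactly when the ratios are eventually bounded away from 0.\<close>

lemma limsup_eq_1_iff_shrinks_fast:
  fixes r :: "nat \<Rightarrow> real"
  assumes "\<And>n. 0 < r n"
  shows "limsup (\<lambda>n. ereal ((r n - r (Suc n)) / r n)) = 1 \<longleftrightarrow> shrinks_fast r"
proof -
  have eq: "(r n - r (Suc n)) / r n = 1 - r (Suc n) / r n" for n
    using assms[of n] by (simp add: diff_divide_distrib)
  have le: "limsup (\<lambda>n. ereal ((r n - r (Suc n)) / r n)) \<le> 1"
    using assms by (intro Limsup_bounded always_eventually) (simp add: eq less_imp_le)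
  show ?thesis
  proof
    assume lim: "limsup (\<lambda>n. ereal ((r n - r (Suc n)) / r n)) = 1"
    show "shrinks_fast r"
      unfolding shrinks_fast_def
    proof (intro allI impI)
      fix \<epsilon> :: real assume "0 < \<epsilon>"
      show "\<exists>\<^sub>F n in sequentially. r (Suc n) \<le> \<epsilon> * r n"
      proof (rule ccontr)
        assume "\<not> ?thesis"
        then have "eventually (\<lambda>n. ereal ((r n - r (Suc n)) / r n) \<le> ereal (1 - \<epsilon>)) sequentially"
          unfolding not_frequently
          by eventually_elim (use assms in \<open>simp add: eq field_simps\<close>)
        then have "limsup (\<lambda>n. ereal ((r n - r (Suc n)) / r n)) \<le> ereal (1 - \<epsilon>)"
          by (rule Limsup_bounded)
        with lim \<open>0 < \<epsilon>\<close> show False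
          by (simp add: one_ereal_def)
      qed
    qed
  next
    assume fast: "shrinks_fast r"
    show "limsup (\<lambda>n. ereal ((r n - r (Suc n)) / r n)) = 1"
    proof (rule antisym[OF le], rule ccontr)
      assume "\<not> 1 \<le> limsup (\<lambda>n. ereal ((r n - r (Suc n)) / r n))"
      then obtain y where y: "limsup (\<lambda>n. ereal ((r n - r (Suc n)) / r n)) < ereal y" "ereal y < 1"
        using ereal_dense2[of "limsup (\<lambda>n. ereal ((r n - r (Suc n)) / r n))" 1] by (auto simp: not_le)
      have "eventually (\<lambda>n. ereal ((r n - r (Suc n)) / r n) < ereal y) sequentially"
        using y(1) by (rule Limsup_lessD)
      then have "eventually (\<lambda>n. \<not> r (Suc n) \<le> (1 - y) * r n) sequentially"
      proof eventually_elim
        case (elim n)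
        then have "1 - y < r (Suc n) / r n" by (simp add: eq)
        then show ?case using assms[of n] by (simp add: less_divide_eq)
      qed
      moreover have "\<exists>\<^sub>F n in sequentially. r (Suc n) \<le> (1 - y) * r n"
        using fast y(2) by (simp add: shrinks_fast_def)
      ultimately show False
        by (simp add: frequently_def)
    qed
  qed
qed

lemma superspeedable_iff_shrinks_fast:
  "superspeedable x \<longleftrightarrow> (\<exists>q. left_approximation q x \<and> shrinks_fast (\<lambda>n. x - of_rat (q n)))"
proof -
  have "limsup (\<lambda>n. ereal ((of_rat (q (Suc n)) - of_rat (q n)) / (x - of_rat (q n)))) = 1
      \<longleftrightarrow> shrinks_fast (\<lambda>n. x - of_rat (q n))" if "left_approximation q x" for q
    using limsup_eq_1_iff_shrinks_fast[of "\<lambda>n. x - of_rat (q n)"] left_approximation_less[OF that]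
    by simp
  then show ?thesis
    unfolding superspeedable_def by blast
qed

lemma shrinks_fast_add_cases:
  assumes "\<And>n. 0 < r n" and "\<And>n. 0 < s n" and "shrinks_fast (\<lambda>n. r n + s n)"
  shows "shrinks_fast r \<or> shrinks_fast s"
proof (rule ccontr)
  assume "\<not> ?thesis"
  then obtain \<epsilon> \<delta> where pos: "0 < \<epsilon>" "0 < \<delta>"
    and r: "eventually (\<lambda>n. \<epsilon> * r n < r (Suc n)) sequentially"
    and s: "eventually (\<lambda>n. \<delta> * s n < s (Suc n)) sequentially"
    by (auto simp: shrinks_fast_def not_frequently not_le)
  \<comment> \<open>The smaller constant serves both sequences, so the two strict inequalities can
    be added.\<close>
  define \<eta> where "\<eta> = min \<epsilon> \<delta>"
  from r s have "eventually (\<lambda>n. \<not> r (Suc n) + s (Suc n) \<le> \<eta> * (r n + s n)) sequentially"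
  proof eventually_elim
    case (elim n)
    have "\<eta> * r n \<le> \<epsilon> * r n" "\<eta> * s n \<le> \<delta> * s n"
      using assms(1)[of n] assms(2)[of n] by (auto simp: \<eta>_def intro!: mult_right_mono)
    with elim show ?case by (simp add: distrib_left)
  qed
  moreover have "\<exists>\<^sub>F n in sequentially. r (Suc n) + s (Suc n) \<le> \<eta> * (r n + s n)"
    using assms(3) pos by (simp add: shrinks_fast_def \<eta>_def)
  ultimately show False
    by (simp add: frequently_def)
qed

text \<open>Since \<open>d\<close> is prescribed, it may be a sum of two approximations; the same
  \<open>t\<close> then reindexes both summands.\<close>

lemma superspeedable_subseq:
  assumes "superspeedable x" and d: "left_approximation d x"
  obtains t where "computable t" and "strict_mono t"
    and "shrinks_fast (\<lambda>n. x - of_rat (d (t n)))"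
proof -
  from assms(1) obtain c where c: "left_approximation c x"
    and fast: "shrinks_fast (\<lambda>n. x - of_rat (c n))"
    unfolding superspeedable_iff_shrinks_fast by blast
  have mono: "strict_mono c" "strict_mono d" and comp: "computable_rat_seq c" "computable_rat_seq d"
    using c d by (simp_all add: left_approximation_def)
  \<comment> \<open>Both searches succeed because each term of one approximation lies strictly below
    \<open>x\<close>, to which the other converges.\<close>
  obtain N where N: "computable N" "\<And>s. d s < c (N s)"
    by (rule computable_search_greater[OF comp(2,1)
          left_approximation_exceeds[OF c left_approximation_less[OF d]]]) blast
  obtain S where S: "computable S" "\<And>n. c n < d (S n)"
    by (rule computable_search_greater[OF comp(1,2)
          left_approximation_exceeds[OF d left_approximation_less[OF c]]]) blast
  \<comment> \<open>One round passes through \<open>c\<close>: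
    \<open>d (t k) < c (N (t k)) < d (t (Suc k))\<close>.\<close>
  define t where "t k = ((\<lambda>s. S (N s)) ^^ k) 0" for k
  have t_comp: "computable t"
    using computable_iterate[OF computable_comp[OF S(1) N(1)]] by (simp add: t_def[abs_def])
  have t_Suc: "t (Suc k) = S (N (t k))" for k
    by (simp add: t_def)
  have "d (t k) < d (t (Suc k))" for k
    using N(2)[of "t k"] S(2)[of "N (t k)"] by (simp add: t_Suc)
  then have t_mono: "strict_mono t"
    by (simp add: strict_mono_Suc_iff strict_mono_less[OF mono(2)])
  have dt: "left_approximation (\<lambda>k. d (t k)) x"
    by (rule left_approximation_subseq[OF d t_comp t_mono])
  define D where "D k = x - of_rat (d (t k))" for k
  have "\<exists>k\<ge>K. D (Suc k) \<le> \<epsilon> * D k" if "0 < \<epsilon>" for \<epsilon> K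
  proof -
    obtain M where M: "d (t K) < c M"
      using left_approximation_exceeds[OF c left_approximation_less[OF d]] by blast
    have "\<exists>\<^sub>F n in sequentially. x - of_rat (c (Suc n)) \<le> \<epsilon>\<^sup>2 * (x - of_rat (c n))"
      using fast \<open>0 < \<epsilon>\<close> by (simp add: shrinks_fast_def)
    then obtain n where n: "M \<le> n" "x - of_rat (c (Suc n)) \<le> \<epsilon>\<^sup>2 * (x - of_rat (c n))"
      by (auto simp: frequently_sequentially)
    have "d (t K) < c n"
      using M n(1) strict_mono_less_eq[OF mono(1), of M n] by simp
    have exceed: "\<exists>k. c n < d (t k)"
      by (rule left_approximation_exceeds[OF dt left_approximation_less[OF c]])
    \<comment> \<open>\<open>j\<close> is the first index at which \<open>d \<circ> t\<close> passes
      \<open>c n\<close>. As \<open>d (t K)\<close> is still below \<open>c n\<close>,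
      \<open>j\<close> exceeds \<open>K\<close> and has a predecessor \<open>k\<close> with
      \<open>d (t k) \<le> c n\<close>.\<close>
    define j where "j = (LEAST k. c n < d (t k))"
    have j: "c n < d (t j)"
      unfolding j_def by (rule LeastI_ex) (rule exceed)
    then have "K < j"
      using less_trans[OF \<open>d (t K) < c n\<close> j]
      by (simp add: strict_mono_less[OF mono(2)] strict_mono_less[OF t_mono])
    then obtain k where k: "j = Suc k" "K \<le> k"
      by (cases j) auto
    have le: "d (t k) \<le> c n"
      using not_less_Least[of k "\<lambda>k. c n < d (t k)"] k(1) by (simp add: j_def)
    \<comment> \<open>The term of \<open>c\<close> found from \<open>d (t j)\<close> has index at
      least \<open>Suc n\<close>, so \<open>d (t (Suc j))\<close> is already above
      \<open>c (Suc n)\<close>.\<close>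
    have "c n < c (N (t j))"
      using j N(2)[of "t j"] by linarith
    then have "c (Suc n) \<le> c (N (t j))"
      by (simp add: strict_mono_less[OF mono(1)] strict_mono_less_eq[OF mono(1)])
    then have "c (Suc n) < d (t (Suc j))"
      using S(2)[of "N (t j)"] by (simp add: t_Suc)
    then have "of_rat (c (Suc n)) < (of_rat (d (t (Suc j))) :: real)"
      by (simp add: of_rat_less)
    then have "D (Suc j) \<le> x - of_rat (c (Suc n))"
      by (simp add: D_def)
    also have "\<dots> \<le> \<epsilon>\<^sup>2 * (x - of_rat (c n))"
      by (rule n(2))
    also have "\<dots> \<le> \<epsilon>\<^sup>2 * D k"
      using le by (intro mult_left_mono) (simp_all add: D_def of_rat_less_eq)
    finally have two: "D (Suc j) \<le> \<epsilon>\<^sup>2 * D k" .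
    show ?thesis
    proof (cases "D j \<le> \<epsilon> * D k")
      case True
      then show ?thesis using k by blast
    next
      \<comment> \<open>If the step from \<open>k\<close> to \<open>j\<close> leaves more than the
        fraction \<open>\<epsilon>\<close>, the bound \<open>\<epsilon>\<^sup>2\<close> over both
        steps forces the step from \<open>j\<close> to leave at most
        \<open>\<epsilon>\<close>.\<close>
      case False
      then have "\<epsilon> * (\<epsilon> * D k) \<le> \<epsilon> * D j"
        using \<open>0 < \<epsilon>\<close> by (intro mult_left_mono) simp_all
      with two have "D (Suc j) \<le> \<epsilon> * D j"
        by (simp add: power2_eq_square mult.assoc)
      then show ?thesis
        using \<open>K < j\<close> by (intro exI[of _ j]) simp
    qed
  qed
  then have "shrinks_fast D"
    by (simp add: shrinks_fast_def frequently_sequentially)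
  then show ?thesis
    using that t_comp t_mono unfolding D_def by blast
qed

theorem theorem19:
  fixes \<alpha> \<beta> :: real
  assumes "left_computable \<alpha>" and "left_computable \<beta>"
    and "superspeedable (\<alpha> + \<beta>)"
  shows "superspeedable \<alpha> \<or> superspeedable \<beta>"
proof -
  from assms(1,2) obtain a b where a: "left_approximation a \<alpha>" and b: "left_approximation b \<beta>"
    unfolding left_computable_def by blast
  obtain t where t: "computable t" "strict_mono t"
    and fast: "shrinks_fast (\<lambda>n. \<alpha> + \<beta> - of_rat (a (t n) + b (t n)))"
    by (rule superspeedable_subseq[OF assms(3) left_approximation_add[OF a b]])
  have at: "left_approximation (\<lambda>n. a (t n)) \<alpha>" and bt: "left_approximation (\<lambda>n. b (t n)) \<beta>"
    using a b t by (simp_all add: left_approximation_subseq)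
  \<comment> \<open>The distance of the sum splits into the two distances, both positive, along the
    common index sequence \<open>t\<close>.\<close>
  have "(\<lambda>n. \<alpha> + \<beta> - of_rat (a (t n) + b (t n)))
      = (\<lambda>n. (\<alpha> - of_rat (a (t n))) + (\<beta> - of_rat (b (t n))))"
    by (simp add: of_rat_add algebra_simps)
  with fast have "shrinks_fast (\<lambda>n. (\<alpha> - of_rat (a (t n))) + (\<beta> - of_rat (b (t n))))"
    by simp
  then have "shrinks_fast (\<lambda>n. \<alpha> - of_rat (a (t n))) \<or> shrinks_fast (\<lambda>n. \<beta> - of_rat (b (t n)))"
    by (intro shrinks_fast_add_cases)
      (simp_all add: left_approximation_less[OF at] left_approximation_less[OF bt])
  with at bt show ?thesis
    unfolding superspeedable_iff_shrinks_fast by blast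
qed

end
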